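(* Let $f$ be chosen uniformly at random from $F(n)$. The probability that there exists $h\in F(n)$ with $h\sim f$ such that $\mathcal{A}(h)$ has at least $0.046\cdot 2^n$ attractors, each of size at most $4$, tends to $1$ as $n\to\infty$.
   Context: $F(n)$ is the set of all functions $f:\{0,1\}^n\to\{0,1\}^n$, written $f=(f_1,\dots,f_n)$. $e_i$ is the configuration with a $1$ exactly in component $i$; addition is componentwise modulo $2$. The asynchronous graph $\mathcal{A}(f)$ is the digraph on $\{0,1\}^n$ with an arc from $x$ to $x+e_i$ whenever $f_i(x)\neq x_i$. An attractor is an inclusion-minimal non-empty set $X\subseteq\{0,1\}^n$ with no arc from $X$ to its complement. $\mathcal{S}(f)$ has an arc $x\to f(x)$ for every $x$; $f\sim h$ means $\mathcal{S}(f)$ and $\mathcal{S}(h)$ are isomorphic. *)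

theory Defs
  imports "HOL-Probability.Probability"
begin

text \<open>Configurations in \<open>{0,1}\<^sup>n\<close> are Boolean lists of length \<open>n\<close>;
  components are indexed by \<open>0, \<dots>, n - 1\<close>.\<close>

definition configs :: "nat \<Rightarrow> bool list set" where
  "configs n = {x. length x = n}"

definition unit_config :: "nat \<Rightarrow> nat \<Rightarrow> bool list" where
  "unit_config n i = map (\<lambda>j. j = i) [0..<n]"

definition add_config :: "bool list \<Rightarrow> bool list \<Rightarrow> bool list" where
  "add_config x y = map2 (\<noteq>) x y"

text \<open>Extensional functions, so that each map on \<open>configs n\<close> is represented exactly once
  and the uniform distribution on \<open>boolean_networks n\<close> is the intended one.\<close>

definition boolean_networks :: "nat \<Rightarrow> (bool list \<Rightarrow> bool list) set" where
  "boolean_networks n = configs n \<rightarrow>\<^sub>E configs n"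

definition async_arcs :: "nat \<Rightarrow> (bool list \<Rightarrow> bool list) \<Rightarrow> (bool list \<times> bool list) set" where
  "async_arcs n f =
     {(x, add_config x (unit_config n i)) | x i. x \<in> configs n \<and> i < n \<and> f x ! i \<noteq> x ! i}"

definition sync_arcs :: "nat \<Rightarrow> (bool list \<Rightarrow> bool list) \<Rightarrow> (bool list \<times> bool list) set" where
  "sync_arcs n f = {(x, f x) | x. x \<in> configs n}"

definition closed_set :: "'a set \<Rightarrow> ('a \<times> 'a) set \<Rightarrow> 'a set \<Rightarrow> bool" where
  "closed_set V E X \<longleftrightarrow> X \<noteq> {} \<and> X \<subseteq> V \<and> \<not> (\<exists>x\<in>X. \<exists>y\<in>V - X. (x, y) \<in> E)"

definition is_attractor :: "'a set \<Rightarrow> ('a \<times> 'a) set \<Rightarrow> 'a set \<Rightarrow> bool" where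
  "is_attractor V E X \<longleftrightarrow>
     closed_set V E X \<and> (\<forall>Y. closed_set V E Y \<and> Y \<subseteq> X \<longrightarrow> Y = X)"

definition digraph_isomorphic ::
  "'a set \<Rightarrow> ('a \<times> 'a) set \<Rightarrow> 'b set \<Rightarrow> ('b \<times> 'b) set \<Rightarrow> bool" where
  "digraph_isomorphic V E W D \<longleftrightarrow>
     (\<exists>p. bij_betw p V W \<and> (\<forall>x\<in>V. \<forall>y\<in>V. (x, y) \<in> E \<longleftrightarrow> (p x, p y) \<in> D))"

definition sync_equiv ::
  "nat \<Rightarrow> (bool list \<Rightarrow> bool list) \<Rightarrow> (bool list \<Rightarrow> bool list) \<Rightarrow> bool" where
  "sync_equiv n f h \<longleftrightarrow>
     digraph_isomorphic (configs n) (sync_arcs n f) (configs n) (sync_arcs n h)"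

lemma finite_configs: "finite (configs n)"
  using finite_lists_length_eq[of "UNIV :: bool set" n] by (simp add: configs_def)

lemma finite_boolean_networks: "finite (boolean_networks n)"
  by (simp add: boolean_networks_def finite_PiE finite_configs)

lemma boolean_networks_nonempty: "boolean_networks n \<noteq> {}"
proof -
  have "replicate n False \<in> configs n" by (simp add: configs_def)
  then show ?thesis by (auto simp: boolean_networks_def PiE_eq_empty_iff)
qed

end

theory Submission
  imports Defs
begin

text \<open>
  Call \<open>v\<close> a tip of \<open>f\<close> if \<open>f a = f b = u\<close> and \<open>f u = v\<close> for distinct points \<open>a, b, u, v\<close>, and
  relabel \<open>u, a, b, v\<close> as the corners \<open>00w, 10w, 01w, 11w\<close> of a square. In the asynchronous graph
  \<open>u\<close> then only moves to \<open>a\<close> or \<open>b\<close>, and these only move back to \<open>u\<close>, so \<open>{u, a, b}\<close> is closed and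
  contains an attractor. Disjoint such quadruples can be relabelled simultaneously.

  The quadruples of two tips can only overlap if one of the tips is \<open>f\<close> or \<open>f \<circ> f\<close> of the other.
  This gives a graph of average degree at most \<open>4\<close> on every subset of tips, so a fifth of all tips
  have pairwise disjoint quadruples.

  For random \<open>f\<close>, the number of preimages of \<open>v\<close> and the in-degrees of these preimages behave like
  independent Poisson(1) variables, so \<open>v\<close> fails to be a tip with probability about
  \<open>\<Sum>k. (1 / e) / k! \<cdot> (2 / e) ^ k = exp (2 / e - 1)\<close>,
  and \<open>1 - exp (2 / e - 1) = 0.2322\<dots> > 5 \<cdot> 0.046\<close>. Changing one value of \<open>f\<close> changes the number of
  tips by at most \<open>2\<close>, so its variance is at most \<open>4 \<cdot> 2\<^sup>n\<close> and Chebyshev's inequality applies.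
\<close>

subsection \<open>Disjoint forks\<close>

lemma exists_indegree_le:
  assumes W: "finite W" "W \<noteq> {}" and outdegree: "\<And>x. x \<in> W \<Longrightarrow> card {y \<in> W. (x, y) \<in> E} \<le> d"
  obtains w where "w \<in> W" "card {x \<in> W. (x, w) \<in> E} \<le> d"
proof (rule ccontr)
  assume "\<not> thesis"
  with that have "Suc d \<le> card {x \<in> W. (x, y) \<in> E}" if "y \<in> W" for y
    using \<open>y \<in> W\<close> by (meson not_less_eq_eq)
  then have "card W * Suc d \<le> (\<Sum>y\<in>W. card {x \<in> W. (x, y) \<in> E})"
    using sum_bounded_below[of W "Suc d" "\<lambda>y. card {x \<in> W. (x, y) \<in> E}"] by simp
  also have "\<dots> = (\<Sum>x\<in>W. card {y \<in> W. (x, y) \<in> E})"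
    by (rule sum_multicount_gen) (simp_all add: W)
  also have "\<dots> \<le> card W * d"
    using sum_bounded_above[of W "\<lambda>x. card {y \<in> W. (x, y) \<in> E}" d] outdegree by simp
  finally show False
    using W by simp
qed

lemma independent_subset_of_outdegree_le:
  assumes "finite W" and "\<And>x. x \<in> W \<Longrightarrow> card {y \<in> W. (x, y) \<in> E} \<le> d"
  shows "\<exists>I\<subseteq>W. card W \<le> (2 * d + 1) * card I \<and> pairwise (\<lambda>x y. (x, y) \<notin> E) I"
  using assms
proof (induction W rule: finite_psubset_induct)
  case (psubset W)
  note outdegree = psubset.prems
  show ?case
  proof (cases "W = {}")
    case False
    then obtain w where "w \<in> W" and indegree: "card {x \<in> W. (x, w) \<in> E} \<le> d"
      using exists_indegree_le[OF psubset.hyps _ outdegree] by blast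
    define J where "J = insert w ({y \<in> W. (w, y) \<in> E} \<union> {x \<in> W. (x, w) \<in> E})"
    have "card J \<le> Suc (card {y \<in> W. (w, y) \<in> E} + card {x \<in> W. (x, w) \<in> E})"
      unfolding J_def using card_Un_le[of "{y \<in> W. (w, y) \<in> E}" "{x \<in> W. (x, w) \<in> E}"]
      by (intro order_trans[OF card_insert_le_m1]) auto
    also have "\<dots> \<le> 2 * d + 1"
      using indegree outdegree[OF \<open>w \<in> W\<close>] by simp
    finally have card_J: "card J \<le> 2 * d + 1" .
    have "J \<subseteq> W" "W - J \<subset> W"
      using \<open>w \<in> W\<close> by (auto simp: J_def)
    moreover have "card {y \<in> W - J. (x, y) \<in> E} \<le> d" if "x \<in> W - J" for x
    proof -
      have "card {y \<in> W - J. (x, y) \<in> E} \<le> card {y \<in> W. (x, y) \<in> E}"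
        using psubset.hyps by (intro card_mono) auto
      then show ?thesis
        using outdegree[of x] that by simp
    qed
    ultimately obtain I where I: "I \<subseteq> W - J" and card_I: "card (W - J) \<le> (2 * d + 1) * card I"
      and indep: "pairwise (\<lambda>x y. (x, y) \<notin> E) I"
      using psubset.IH by meson
    have "finite I" "w \<notin> I"
      using I psubset.hyps by (auto simp: J_def intro: finite_subset)
    have "card W \<le> card J + card (W - J)"
      using card_Un_le[of J "W - J"] \<open>J \<subseteq> W\<close> by (simp add: Un_absorb1)
    also have "\<dots> \<le> (2 * d + 1) * card (insert w I)"
      using card_I card_J \<open>finite I\<close> \<open>w \<notin> I\<close> by simp
    finally have "card W \<le> (2 * d + 1) * card (insert w I)" .
    moreover have "insert w I \<subseteq> W"
      using I \<open>w \<in> W\<close> by auto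
    moreover have "pairwise (\<lambda>x y. (x, y) \<notin> E) (insert w I)"
      using I indep by (auto simp: pairwise_insert J_def)
    ultimately show ?thesis by blast
  qed auto
qed

text \<open>A fork is indexed by the corners of the square onto which it will be relabelled.\<close>

definition fork :: "'a set \<Rightarrow> ('a \<Rightarrow> 'a) \<Rightarrow> (bool \<times> bool \<Rightarrow> 'a) \<Rightarrow> bool" where
  "fork V f c \<longleftrightarrow> inj c \<and> range c \<subseteq> V \<and>
     f (c (True, False)) = c (False, False) \<and> f (c (False, True)) = c (False, False) \<and>
     f (c (False, False)) = c (True, True)"

definition fork_tips :: "'a set \<Rightarrow> ('a \<Rightarrow> 'a) \<Rightarrow> 'a set" where
  "fork_tips V f = {c (True, True) | c. fork V f c}"

lemma fork_tips_subset: "fork_tips V f \<subseteq> V"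
  by (auto simp: fork_tips_def fork_def)

lemma finite_fork_tips: "finite V \<Longrightarrow> finite (fork_tips V f)"
  using fork_tips_subset by (rule finite_subset)

lemma fork_tipsI:
  assumes "{a, b, u, v} \<subseteq> V" "distinct [a, b, u, v]" "f a = u" "f b = u" "f u = v"
  shows "v \<in> fork_tips V f"
proof -
  define c where "c = (\<lambda>(s, t). if s then if t then v else a else if t then b else u)"
  have "fork V f c"
    using assms by (auto simp: fork_def c_def inj_on_def)
  moreover have "c (True, True) = v"
    by (simp add: c_def)
  ultimately show ?thesis
    unfolding fork_tips_def by blast
qed

lemma fork_tip_in_orbit:
  assumes "fork V f c" "x \<in> range c"
  shows "c (True, True) \<in> {x, f x, f (f x)}"
proof -
  obtain s t where "x = c (s, t)"
    using assms(2) by auto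
  then show ?thesis
    using assms(1) by (cases s; cases t) (auto simp: fork_def)
qed

lemma forks_disjoint:
  assumes fork_c: "fork V f c" and tip_c: "c (True, True) = v"
    and fork_d: "fork V f d" and tip_d: "d (True, True) = w"
    and neq: "v \<noteq> w" "w \<noteq> f v" "w \<noteq> f (f v)" "v \<noteq> f w" "v \<noteq> f (f w)"
  shows "range c \<inter> range d = {}"
proof (rule ccontr)
  assume "range c \<inter> range d \<noteq> {}"
  then obtain x where "x \<in> range c" "x \<in> range d" by blast
  then have "v \<in> {x, f x, f (f x)}" "w \<in> {x, f x, f (f x)}"
    using fork_tip_in_orbit[OF fork_c] fork_tip_in_orbit[OF fork_d] tip_c tip_d by auto
  then show False
    using neq by auto
qed

lemma fork_fun_upd:
  assumes "fork V f c" "x \<notin> {c (True, False), c (False, True), c (False, False)}"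
  shows "fork V (f(x := y)) c"
  using assms by (auto simp: fork_def)

lemma fork_tips_fun_upd_subset:
  "fork_tips V f \<subseteq> fork_tips V (f(x := y)) \<union> {f x, f (f x)}"
proof
  fix v assume "v \<in> fork_tips V f"
  then obtain c where fork_c: "fork V f c" and tip_c: "c (True, True) = v"
    by (auto simp: fork_tips_def)
  show "v \<in> fork_tips V (f(x := y)) \<union> {f x, f (f x)}"
  proof (cases "x \<in> {c (True, False), c (False, True), c (False, False)}")
    case True
    then show ?thesis
      using fork_c tip_c by (auto simp: fork_def)
  next
    case False
    from fork_fun_upd[OF fork_c this] show ?thesis
      using tip_c by (auto simp: fork_tips_def)
  qed
qed

lemma card_fork_tips_fun_upd:
  assumes "finite V"
  shows "\<bar>real (card (fork_tips V (f(x := y)))) - real (card (fork_tips V f))\<bar> \<le> 2"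
proof -
  have card_le: "card (fork_tips V g) \<le> card (fork_tips V (g(x := z))) + 2" for g z
  proof -
    have "card (fork_tips V g) \<le> card (fork_tips V (g(x := z)) \<union> {g x, g (g x)})"
      using assms by (intro card_mono fork_tips_fun_upd_subset) (simp add: finite_fork_tips)
    also have "\<dots> \<le> card (fork_tips V (g(x := z))) + card {g x, g (g x)}"
      by (rule card_Un_le)
    also have "\<dots> \<le> card (fork_tips V (g(x := z))) + 2"
      by (simp add: card_insert_if)
    finally show ?thesis .
  qed
  show ?thesis
    using card_le[of f y] card_le[of "f(x := y)" "f x"] by simp
qed

lemma exists_disjoint_forks:
  assumes "finite V"
  obtains I c where "I \<subseteq> V" "card (fork_tips V f) \<le> 5 * card I"
    "\<And>v. v \<in> I \<Longrightarrow> fork V f (c v)" "disjoint_family_on (\<lambda>v. range (c v)) I"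
proof -
  define E where "E = {(v, w). w = f v \<or> w = f (f v)}"
  have outdegree: "card {w \<in> fork_tips V f. (v, w) \<in> E} \<le> 2" for v
  proof -
    have "card {w \<in> fork_tips V f. (v, w) \<in> E} \<le> card {f v, f (f v)}"
      by (intro card_mono) (auto simp: E_def)
    also have "\<dots> \<le> 2"
      by (simp add: card_insert_if)
    finally show ?thesis .
  qed
  obtain I where I_tips: "I \<subseteq> fork_tips V f"
    and card_I: "card (fork_tips V f) \<le> (2 * 2 + 1) * card I"
    and indep: "pairwise (\<lambda>v w. (v, w) \<notin> E) I"
    using independent_subset_of_outdegree_le[OF finite_fork_tips[OF assms] outdegree] by blast
  have "\<forall>v\<in>I. \<exists>c. fork V f c \<and> c (True, True) = v"
    using I_tips by (auto simp: fork_tips_def)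
  then obtain c where fork_c: "\<And>v. v \<in> I \<Longrightarrow> fork V f (c v)"
    and tip_c: "\<And>v. v \<in> I \<Longrightarrow> c v (True, True) = v"
    by metis
  have "range (c v) \<inter> range (c w) = {}" if "v \<in> I" "w \<in> I" "v \<noteq> w" for v w
  proof (rule forks_disjoint[OF fork_c tip_c fork_c tip_c])
    show "w \<noteq> f v" "w \<noteq> f (f v)" "v \<noteq> f w" "v \<noteq> f (f w)"
      using pairwiseD[OF indep that] pairwiseD[OF indep that(2,1)] that(3) by (auto simp: E_def)
  qed (use that in auto)
  then have disj: "disjoint_family_on (\<lambda>v. range (c v)) I"
    by (simp add: disjoint_family_on_def)
  show thesis
  proof (rule that[OF _ _ fork_c disj])
    show "I \<subseteq> V"
      using I_tips fork_tips_subset by (rule subset_trans)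
    show "card (fork_tips V f) \<le> 5 * card I"
      using card_I by simp
  qed
qed

subsection \<open>Attractors of relabelled networks\<close>

lemma bij_betw_extend:
  assumes "finite S" "finite T" "card S = card T"
    and inj_P: "inj_on P Z" and P_image: "P ` Z \<subseteq> S"
    and inj_Q: "inj_on Q Z" and Q_image: "Q ` Z \<subseteq> T"
  obtains p where "bij_betw p S T" "\<And>z. z \<in> Z \<Longrightarrow> p (P z) = Q z"
proof -
  have "finite (P ` Z)" "finite (Q ` Z)"
    using assms finite_subset by blast+
  then have "card (S - P ` Z) = card (T - Q ` Z)"
    using assms by (simp add: card_Diff_subset card_image)
  then obtain r where r: "bij_betw r (S - P ` Z) (T - Q ` Z)"
    using assms(1,2) finite_same_card_bij[of "S - P ` Z" "T - Q ` Z"] by auto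
  define p where "p x = (if x \<in> P ` Z then Q (inv_into Z P x) else r x)" for x
  have p_P: "p (P z) = Q z" if "z \<in> Z" for z
    using that inj_P by (simp add: p_def)
  have "bij_betw p (P ` Z) (Q ` Z)"
  proof (rule bij_betw_imageI)
    show "inj_on p (P ` Z)"
      using inj_Q p_P by (auto simp: inj_on_def)
    show "p ` P ` Z = Q ` Z"
      using p_P by (auto simp: image_iff)
  qed
  moreover have "bij_betw p (S - P ` Z) (T - Q ` Z)"
    using r by (subst bij_betw_cong[of _ _ r]) (auto simp: p_def)
  ultimately have "bij_betw p (P ` Z \<union> (S - P ` Z)) (Q ` Z \<union> (T - Q ` Z))"
    by (rule bij_betw_combine) auto
  then have "bij_betw p S T"
    using P_image Q_image by (simp add: Un_absorb1)
  then show thesis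
    using that p_P by blast
qed

lemma closed_set_contains_attractor:
  assumes "finite X" "closed_set V E X"
  shows "\<exists>Y\<subseteq>X. is_attractor V E Y"
  using assms
proof (induction X rule: finite_psubset_induct)
  case (psubset X)
  show ?case
  proof (cases "is_attractor V E X")
    case False
    with psubset.prems obtain Y where "Y \<subset> X" "closed_set V E Y"
      unfolding is_attractor_def by blast
    from psubset.IH[OF this] \<open>Y \<subset> X\<close> show ?thesis by auto
  qed auto
qed

lemma card_attractors_ge:
  assumes V: "finite V"
    and closed: "\<And>v. v \<in> I \<Longrightarrow> closed_set V E (X v)"
    and disj: "disjoint_family_on X I"
    and small: "\<And>v. v \<in> I \<Longrightarrow> card (X v) \<le> k"
  shows "card I \<le> card {Y. is_attractor V E Y \<and> card Y \<le> k}"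
proof -
  have fin: "finite (X v)" if "v \<in> I" for v
    using closed[OF that] V by (auto simp: closed_set_def intro: finite_subset)
  have "\<exists>Y\<subseteq>X v. is_attractor V E Y" if "v \<in> I" for v
    using fin[OF that] closed[OF that] by (rule closed_set_contains_attractor)
  then obtain Y where Y_subset: "\<And>v. v \<in> I \<Longrightarrow> Y v \<subseteq> X v"
    and attractor_Y: "\<And>v. v \<in> I \<Longrightarrow> is_attractor V E (Y v)"
    by metis
  have nonempty: "Y v \<noteq> {}" if "v \<in> I" for v
    using attractor_Y[OF that] by (simp add: is_attractor_def closed_set_def)
  have "inj_on Y I"
  proof (rule inj_onI, rule ccontr)
    fix v w assume v: "v \<in> I" and w: "w \<in> I" and "Y v = Y w" "v \<noteq> w"
    then have "Y v \<subseteq> X v \<inter> X w"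
      using Y_subset[OF v] Y_subset[OF w] by simp
    then show False
      using disjoint_family_onD[OF disj v w \<open>v \<noteq> w\<close>] nonempty[OF v] by simp
  qed
  moreover have "card (Y v) \<le> k" if "v \<in> I" for v
    using card_mono[OF fin[OF that] Y_subset[OF that]] small[OF that] by simp
  then have "Y ` I \<subseteq> {Y. is_attractor V E Y \<and> card Y \<le> k}"
    using attractor_Y by auto
  moreover have "{Y. is_attractor V E Y \<and> card Y \<le> k} \<subseteq> Pow V"
    by (auto simp: is_attractor_def closed_set_def)
  then have "finite {Y. is_attractor V E Y \<and> card Y \<le> k}"
    using V by (meson finite_Pow_iff finite_subset)
  ultimately show ?thesis by (rule card_inj_on_le)
qed

lemma card_configs: "card (configs n) = 2 ^ n"
  using card_lists_length_eq[of "UNIV :: bool set" n] by (simp add: configs_def)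

lemma add_unit_config:
  assumes "x \<in> configs n" "i < n"
  shows "add_config x (unit_config n i) = x[i := \<not> x ! i]"
  using assms
  by (intro nth_equalityI) (auto simp: configs_def add_config_def unit_config_def nth_list_update)

lemma async_arc_cases:
  assumes "(s # t # w, y) \<in> async_arcs n h" "h (s # t # w) = s' # t' # w"
  shows "s \<noteq> s' \<and> y = s' # t # w \<or> t \<noteq> t' \<and> y = s # t' # w"
proof -
  from assms(1) obtain i where "s # t # w \<in> configs n" "i < n"
    and changed: "h (s # t # w) ! i \<noteq> (s # t # w) ! i"
    and flipped: "y = add_config (s # t # w) (unit_config n i)"
    unfolding async_arcs_def by blast
  then have y: "y = (s # t # w)[i := \<not> (s # t # w) ! i]"
    by (simp add: add_unit_config)
  have "i < 2"
    using changed assms(2) by (auto simp: nth_Cons split: nat.splits)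
  then consider "i = 0" | "i = 1" by linarith
  then show ?thesis
    using changed y assms(2) by cases auto
qed

definition square_trap :: "bool list \<Rightarrow> bool list set" where
  "square_trap w = {False # False # w, True # False # w, False # True # w}"

lemma closed_set_square_trap:
  assumes "w \<in> configs n" and "h (False # False # w) = True # True # w"
    "h (True # False # w) = False # False # w" "h (False # True # w) = False # False # w"
  shows "closed_set (configs (Suc (Suc n))) (async_arcs (Suc (Suc n)) h) (square_trap w)"
  using assms
  by (auto simp: closed_set_def square_trap_def configs_def dest!: async_arc_cases)

lemma square_traps_disjoint: "w \<noteq> w' \<Longrightarrow> square_trap w \<inter> square_trap w' = {}"
  by (auto simp: square_trap_def)

lemma card_square_trap_le: "card (square_trap w) \<le> 4"
  by (simp add: square_trap_def card_insert_if)

lemma conjugate_network: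
  assumes f: "f \<in> boolean_networks n" and p: "bij_betw p (configs n) (configs n)"
  obtains h where "h \<in> boolean_networks n" "sync_equiv n h f"
    "\<And>x. x \<in> configs n \<Longrightarrow> h (p x) = p (f x)"
proof
  let ?V = "configs n"
  define q where "q = inv_into ?V p"
  define h where "h = restrict (p \<circ> f \<circ> q) ?V"
  have q: "bij_betw q ?V ?V"
    unfolding q_def using p by (rule bij_betw_inv_into)
  have qp: "q (p x) = x" and pq: "p (q x) = x" if "x \<in> ?V" for x
    using that p unfolding q_def by (auto simp: bij_betw_inv_into_left bij_betw_inv_into_right)
  have closed: "f x \<in> ?V" "p x \<in> ?V" "q x \<in> ?V" if "x \<in> ?V" for x
    using that f p q by (auto simp: boolean_networks_def bij_betw_def)
  show "h \<in> boolean_networks n"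
    using closed by (auto simp: h_def boolean_networks_def)
  show "h (p x) = p (f x)" if "x \<in> ?V" for x
    using that closed qp by (simp add: h_def)
  have "(x, y) \<in> sync_arcs n h \<longleftrightarrow> (q x, q y) \<in> sync_arcs n f" if "x \<in> ?V" "y \<in> ?V" for x y
  proof -
    have "y = p (f (q x)) \<longleftrightarrow> q y = f (q x)"
      using that closed pq qp by metis
    then show ?thesis
      using that closed by (auto simp: sync_arcs_def h_def)
  qed
  then show "sync_equiv n h f"
    unfolding sync_equiv_def digraph_isomorphic_def using q by blast
qed

lemma inj_on_case_prod_disjoint_ranges:
  assumes inj: "\<And>v. v \<in> I \<Longrightarrow> inj (c v)" and disj: "disjoint_family_on (\<lambda>v. range (c v)) I"
  shows "inj_on (case_prod c) (I \<times> UNIV)"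
proof (rule inj_onI, clarify)
  fix v z w y assume v: "v \<in> I" and w: "w \<in> I" and eq: "c v z = c w y"
  have "range (c v) \<inter> range (c w) \<noteq> {}"
    using eq by (metis IntI empty_iff rangeI)
  then have "v = w"
    using disjoint_family_onD[OF disj v w] by blast
  then show "v = w \<and> z = y"
    using eq injD[OF inj[OF v]] by simp
qed

lemma exists_relabelling_to_squares:
  fixes c :: "'a \<Rightarrow> bool \<times> bool \<Rightarrow> bool list"
  assumes "finite I" and inj: "\<And>v. v \<in> I \<Longrightarrow> inj (c v)"
    and range: "\<And>v. v \<in> I \<Longrightarrow> range (c v) \<subseteq> configs (Suc (Suc n))"
    and disj: "disjoint_family_on (\<lambda>v. range (c v)) I"
  obtains p w where "bij_betw p (configs (Suc (Suc n))) (configs (Suc (Suc n)))" "inj_on w I"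
    "w ` I \<subseteq> configs n" "\<And>v s t. v \<in> I \<Longrightarrow> p (c v (s, t)) = s # t # w v"
proof -
  let ?V = "configs (Suc (Suc n))" and ?Z = "I \<times> (UNIV :: (bool \<times> bool) set)"
  have inj_c: "inj_on (case_prod c) ?Z"
    using inj disj by (rule inj_on_case_prod_disjoint_ranges)
  have c_image: "case_prod c ` ?Z \<subseteq> ?V"
    using range by auto
  have "4 * card I = card ?Z"
    by (simp add: card_cartesian_product card_UNIV_bool flip: UNIV_Times_UNIV)
  also have "\<dots> \<le> card ?V"
    using inj_c c_image finite_configs by (rule card_inj_on_le)
  finally have "card I \<le> card (configs n)"
    by (simp add: card_configs)
  then obtain w where w_image: "w ` I \<subseteq> configs n" and inj_w: "inj_on w I"
    using card_le_inj[OF \<open>finite I\<close> finite_configs] by blast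
  define Q where "Q = (\<lambda>(v, s, t). s # t # w v)"
  have inj_Q: "inj_on Q ?Z" and Q_image: "Q ` ?Z \<subseteq> ?V"
    using w_image inj_w by (auto simp: inj_on_def Q_def configs_def)
  obtain p where p: "bij_betw p ?V ?V" and p_c: "\<And>z. z \<in> ?Z \<Longrightarrow> p (case_prod c z) = Q z"
    using bij_betw_extend[OF finite_configs finite_configs refl inj_c c_image inj_Q Q_image]
    by blast
  have "p (c v (s, t)) = s # t # w v" if "v \<in> I" for v s t
    using p_c[of "(v, s, t)"] that by (simp add: Q_def)
  then show thesis
    by (rule that[OF p inj_w w_image])
qed

definition small_attractors :: "nat \<Rightarrow> (bool list \<Rightarrow> bool list) \<Rightarrow> bool list set set" where
  "small_attractors n h = {X. is_attractor (configs n) (async_arcs n h) X \<and> card X \<le> 4}"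

lemma exists_sync_equiv_many_small_attractors:
  assumes f: "f \<in> boolean_networks n" and n: "2 \<le> n"
  shows "\<exists>h\<in>boolean_networks n. sync_equiv n h f \<and>
    card (fork_tips (configs n) f) \<le> 5 * card (small_attractors n h)"
proof -
  let ?V = "configs n"
  obtain m where m: "n = Suc (Suc m)"
    using n by (metis add_2_eq_Suc le_Suc_ex)
  obtain I c where "I \<subseteq> ?V" and card_I: "card (fork_tips ?V f) \<le> 5 * card I"
    and fork: "\<And>v. v \<in> I \<Longrightarrow> fork ?V f (c v)"
    and disj: "disjoint_family_on (\<lambda>v. range (c v)) I"
    using exists_disjoint_forks[of ?V f, OF finite_configs] by blast
  have "finite I"
    using \<open>I \<subseteq> ?V\<close> finite_configs by (rule finite_subset)
  then obtain p w where p: "bij_betw p ?V ?V"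
    and inj_w: "inj_on w I" and w_image: "w ` I \<subseteq> configs m"
    and p_c: "\<And>v s t. v \<in> I \<Longrightarrow> p (c v (s, t)) = s # t # w v"
    using fork disj exists_relabelling_to_squares[of I c m] unfolding m fork_def by blast
  obtain h where h: "h \<in> boolean_networks n" "sync_equiv n h f"
    and h_p: "\<And>x. x \<in> ?V \<Longrightarrow> h (p x) = p (f x)"
    using conjugate_network[OF f p] by blast
  have "closed_set ?V (async_arcs n h) (square_trap (w v))" if v: "v \<in> I" for v
  proof -
    have h_c: "h (s # t # w v) = p (f (c v (s, t)))" for s t
    proof -
      have "c v (s, t) \<in> ?V"
        using fork[OF v] by (auto simp: fork_def)
      from h_p[OF this] show ?thesis
        by (simp add: p_c v)
    qed
    have "w v \<in> configs m"
      using w_image v by auto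
    then show ?thesis
      unfolding m
      by (rule closed_set_square_trap) (use fork[OF v] p_c[OF v] in \<open>simp_all add: h_c fork_def\<close>)
  qed
  moreover have "disjoint_family_on (\<lambda>v. square_trap (w v)) I"
    unfolding disjoint_family_on_def using inj_w square_traps_disjoint by (metis inj_onD)
  ultimately have "card I \<le> card (small_attractors n h)"
    unfolding small_attractors_def
    by (rule card_attractors_ge[OF finite_configs _ _ card_square_trap_le])
  with card_I h show ?thesis
    by (intro bexI[of _ h]) auto
qed

subsection \<open>Bounded differences under product distributions\<close>

lemma integrable_measure_pmf_bounded:
  fixes X :: "'a \<Rightarrow> real"
  assumes "\<And>x. \<bar>X x\<bar> \<le> B"
  shows "integrable (measure_pmf p) X"
  using assms by (intro measure_pmf.integrable_const_bound[of _ B]) auto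

lemma abs_expectation_pmf_le:
  fixes X :: "'a \<Rightarrow> real"
  assumes "\<And>x. \<bar>X x\<bar> \<le> B"
  shows "\<bar>measure_pmf.expectation p X\<bar> \<le> B"
proof -
  have "\<bar>measure_pmf.expectation p X\<bar> \<le> measure_pmf.expectation p (\<lambda>x. \<bar>X x\<bar>)"
    by (rule integral_abs_bound)
  also have "\<dots> \<le> B"
    using assms by (intro measure_pmf.integral_le_const integrable_measure_pmf_bounded) auto
  finally show ?thesis .
qed

lemma expectation_pair_pmf_nonneg:
  fixes X :: "'a \<times> 'b \<Rightarrow> real"
  assumes nonneg: "\<And>z. 0 \<le> X z" and bound: "\<And>z. X z \<le> B"
  shows "measure_pmf.expectation (pair_pmf p q) X
    = measure_pmf.expectation p (\<lambda>x. measure_pmf.expectation q (\<lambda>y. X (x, y)))"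
proof -
  have abs_le: "\<bar>X z\<bar> \<le> B" for z
    using nonneg bound by simp
  have "ennreal (measure_pmf.expectation (pair_pmf p q) X) = (\<integral>\<^sup>+z. X z \<partial>pair_pmf p q)"
    using nonneg abs_le
    by (intro nn_integral_eq_integral[symmetric] integrable_measure_pmf_bounded) auto
  also have "\<dots> = (\<integral>\<^sup>+x. \<integral>\<^sup>+y. X (x, y) \<partial>q \<partial>p)"
    by (rule nn_integral_pair_pmf')
  also have "\<dots> = (\<integral>\<^sup>+x. measure_pmf.expectation q (\<lambda>y. X (x, y)) \<partial>p)"
    using nonneg abs_le
    by (intro nn_integral_cong nn_integral_eq_integral integrable_measure_pmf_bounded) auto
  also have "\<dots> = measure_pmf.expectation p (\<lambda>x. measure_pmf.expectation q (\<lambda>y. X (x, y)))"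
    using nonneg abs_le
    by (intro nn_integral_eq_integral integrable_measure_pmf_bounded abs_expectation_pmf_le AE_I2
        Bochner_Integration.integral_nonneg) auto
  finally show ?thesis
    using nonneg by (simp add: Bochner_Integration.integral_nonneg)
qed

lemma expectation_pair_pmf:
  fixes X :: "'a \<times> 'b \<Rightarrow> real"
  assumes bound: "\<And>z. \<bar>X z\<bar> \<le> B"
  shows "measure_pmf.expectation (pair_pmf p q) X
    = measure_pmf.expectation p (\<lambda>x. measure_pmf.expectation q (\<lambda>y. X (x, y)))"
proof -
  have "0 \<le> X z + B" "X z + B \<le> 2 * B" for z
    using bound[of z] by linarith+
  from expectation_pair_pmf_nonneg[OF this]
  have "measure_pmf.expectation (pair_pmf p q) (\<lambda>z. X z + B)
      = measure_pmf.expectation p (\<lambda>x. measure_pmf.expectation q (\<lambda>y. X (x, y) + B))" .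
  then show ?thesis
    by (simp add: bound integrable_measure_pmf_bounded[of _ B] abs_expectation_pmf_le)
qed

lemma abs_power2_le:
  fixes y :: real
  assumes "\<bar>y\<bar> \<le> B"
  shows "\<bar>y\<^sup>2\<bar> \<le> B\<^sup>2"
  using power_mono[OF assms, of 2] by simp

lemma variance_pmf_bounded_eq:
  fixes X :: "'a \<Rightarrow> real"
  assumes "\<And>x. \<bar>X x\<bar> \<le> B"
  shows "measure_pmf.variance p X
    = measure_pmf.expectation p (\<lambda>x. (X x)\<^sup>2) - (measure_pmf.expectation p X)\<^sup>2"
proof (rule measure_pmf.variance_eq)
  show "integrable (measure_pmf p) X"
    using assms by (rule integrable_measure_pmf_bounded)
  show "integrable (measure_pmf p) (\<lambda>x. (X x)\<^sup>2)"
    using assms by (rule integrable_measure_pmf_bounded[OF abs_power2_le])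
qed

lemma variance_pair_pmf:
  fixes X :: "'a \<times> 'b \<Rightarrow> real"
  assumes bound: "\<And>z. \<bar>X z\<bar> \<le> B"
  shows "measure_pmf.variance (pair_pmf p q) X
    = measure_pmf.expectation p (\<lambda>x. measure_pmf.variance q (\<lambda>y. X (x, y)))
      + measure_pmf.variance p (\<lambda>x. measure_pmf.expectation q (\<lambda>y. X (x, y)))"
proof -
  have mean_bound: "\<bar>measure_pmf.expectation q (\<lambda>y. X (x, y))\<bar> \<le> B" for x
    by (intro abs_expectation_pmf_le bound)
  have mean_square_bound: "\<bar>measure_pmf.expectation q (\<lambda>y. (X (x, y))\<^sup>2)\<bar> \<le> B\<^sup>2" for x
    by (intro abs_expectation_pmf_le abs_power2_le bound)
  have "measure_pmf.variance (pair_pmf p q) X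
      = measure_pmf.expectation (pair_pmf p q) (\<lambda>z. (X z)\<^sup>2)
        - (measure_pmf.expectation (pair_pmf p q) X)\<^sup>2"
    by (rule variance_pmf_bounded_eq) (rule bound)
  also have "\<dots> = measure_pmf.expectation p (\<lambda>x. measure_pmf.expectation q (\<lambda>y. (X (x, y))\<^sup>2))
      - (measure_pmf.expectation p (\<lambda>x. measure_pmf.expectation q (\<lambda>y. X (x, y))))\<^sup>2"
    by (simp add: expectation_pair_pmf[OF bound] expectation_pair_pmf[OF abs_power2_le[OF bound]])
  also have "\<dots> = measure_pmf.expectation p (\<lambda>x. measure_pmf.variance q (\<lambda>y. X (x, y)))
      + measure_pmf.variance p (\<lambda>x. measure_pmf.expectation q (\<lambda>y. X (x, y)))"
    using mean_square_bound abs_power2_le[OF mean_bound]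
    by (simp add: variance_pmf_bounded_eq[of _ B] bound mean_bound
        integrable_measure_pmf_bounded[of _ "B\<^sup>2"])
  finally show ?thesis .
qed

lemma variance_pmf_le_of_deviation_le:
  fixes X :: "'a \<Rightarrow> real"
  assumes dev: "\<And>x. \<bar>X x - a\<bar> \<le> c"
  shows "measure_pmf.variance p X \<le> c\<^sup>2"
proof -
  have square: "(X x - a)\<^sup>2 \<le> c\<^sup>2" for x
    using power_mono[OF dev, of x 2] by simp
  have integrable: "integrable (measure_pmf p) (\<lambda>x. X x - a)"
    using dev by (rule integrable_measure_pmf_bounded)
  have integrable_square: "integrable (measure_pmf p) (\<lambda>x. (X x - a)\<^sup>2)"
    using square by (intro integrable_measure_pmf_bounded[of _ "c\<^sup>2"]) auto
  have "integrable (measure_pmf p) (\<lambda>x. (X x - a) + a)"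
    by (intro Bochner_Integration.integrable_add integrable) simp
  then have "measure_pmf.variance p X = measure_pmf.variance p (\<lambda>x. X x - a)"
    by simp
  also have "\<dots> \<le> measure_pmf.expectation p (\<lambda>x. (X x - a)\<^sup>2)"
    unfolding measure_pmf.variance_eq[OF integrable integrable_square] by simp
  also have "\<dots> \<le> c\<^sup>2"
    using integrable_square square by (intro measure_pmf.integral_le_const) auto
  finally show ?thesis .
qed

text \<open>An Efron--Stein bound, by conditioning on one coordinate at a time.\<close>

lemma variance_Pi_pmf_le:
  fixes X :: "('a \<Rightarrow> 'b) \<Rightarrow> real"
  assumes "finite V" and "\<And>f. \<bar>X f\<bar> \<le> B"
    and "\<And>f x y. x \<in> V \<Longrightarrow> \<bar>X (f(x := y)) - X f\<bar> \<le> c x"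
  shows "measure_pmf.variance (Pi_pmf V d p) X \<le> (\<Sum>x\<in>V. (c x)\<^sup>2)"
  using assms
proof (induction V arbitrary: X rule: finite_induct)
  case empty
  then show ?case by simp
next
  case (insert x V)
  note bound = insert.prems(1) and diff = insert.prems(2)
  let ?P = "Pi_pmf V d p"
  define M where "M y = measure_pmf.expectation ?P (\<lambda>f. X (f(x := y)))" for y
  have "\<bar>X (f(z := w, x := y)) - X (f(x := y))\<bar> \<le> c z" if "z \<in> V" for f y z w
    using that insert.hyps diff[of z "f(x := y)" w] by (metis fun_upd_twist insertI2)
  then have fibre: "measure_pmf.variance ?P (\<lambda>f. X (f(x := y))) \<le> (\<Sum>z\<in>V. (c z)\<^sup>2)" for y
    by (intro insert.IH bound)
  have "M y - measure_pmf.expectation ?P X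
      = measure_pmf.expectation ?P (\<lambda>f. X (f(x := y)) - X f)" for y
    unfolding M_def by (intro Bochner_Integration.integral_diff[symmetric]
        integrable_measure_pmf_bounded[of _ B] bound)
  then have mean: "measure_pmf.variance (p x) M \<le> (c x)\<^sup>2"
    using diff[of x]
    by (intro variance_pmf_le_of_deviation_le[of _ "measure_pmf.expectation ?P X"])
      (simp del: fun_upd_apply add: abs_expectation_pmf_le)
  have "measure_pmf.variance (Pi_pmf (insert x V) d p) X
      = measure_pmf.variance (pair_pmf (p x) ?P) (\<lambda>(y, f). X (f(x := y)))"
    by (simp add: Pi_pmf_insert insert.hyps case_prod_unfold)
  also have "\<dots> = measure_pmf.expectation (p x) (\<lambda>y. measure_pmf.variance ?P (\<lambda>f. X (f(x := y))))
      + measure_pmf.variance (p x) M"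
    unfolding M_def by (subst variance_pair_pmf[of _ B]) (auto simp: bound)
  also have "\<dots> \<le> (\<Sum>z\<in>V. (c z)\<^sup>2) + (c x)\<^sup>2"
  proof (rule add_mono[OF measure_pmf.integral_le_const mean])
    show "integrable (p x) (\<lambda>y. measure_pmf.variance ?P (\<lambda>f. X (f(x := y))))"
      by (rule integrable_measure_pmf_bounded[of _ "\<Sum>z\<in>V. (c z)\<^sup>2"]) (simp add: fibre)
  qed (simp add: fibre)
  also have "\<dots> = (\<Sum>z\<in>insert x V. (c z)\<^sup>2)"
    using insert.hyps by simp
  finally show ?case .
qed

lemma PiE_dflt_undefined: "PiE_dflt V undefined (\<lambda>_. C) = V \<rightarrow>\<^sub>E C"
  by (auto simp: PiE_dflt_def PiE_def extensional_def)

lemma lower_tail_pmf_of_set_PiE_le: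
  fixes X :: "('a \<Rightarrow> 'b) \<Rightarrow> real"
  assumes V: "finite V" and C: "finite C" "C \<noteq> {}" and bound: "\<And>f. \<bar>X f\<bar> \<le> B"
    and diff: "\<And>f x y. x \<in> V \<Longrightarrow> \<bar>X (f(x := y)) - X f\<bar> \<le> c x"
    and gap: "0 < a" "t + a \<le> measure_pmf.expectation (pmf_of_set (V \<rightarrow>\<^sub>E C)) X"
  shows "measure_pmf.prob (pmf_of_set (V \<rightarrow>\<^sub>E C)) {f. X f < t} \<le> (\<Sum>x\<in>V. (c x)\<^sup>2) / a\<^sup>2"
proof -
  define P where "P = pmf_of_set (V \<rightarrow>\<^sub>E C)"
  have P: "P = Pi_pmf V undefined (\<lambda>_. pmf_of_set C)"
    using V C by (simp add: P_def Pi_pmf_of_set PiE_dflt_undefined)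
  have "integrable P (\<lambda>f. (X f)\<^sup>2)"
    by (rule integrable_measure_pmf_bounded) (rule abs_power2_le[OF bound])
  then have chebyshev: "measure_pmf.prob P {f. a \<le> \<bar>X f - measure_pmf.expectation P X\<bar>}
      \<le> measure_pmf.variance P X / a\<^sup>2"
    using measure_pmf.Chebyshev_inequality[of X P a] \<open>0 < a\<close> by simp
  have "measure_pmf.prob P {f. X f < t}
      \<le> measure_pmf.prob P {f. a \<le> \<bar>X f - measure_pmf.expectation P X\<bar>}"
    using gap by (intro measure_pmf.finite_measure_mono) (auto simp: P_def)
  also have "\<dots> \<le> measure_pmf.variance P X / a\<^sup>2"
    by (rule chebyshev)
  also have "\<dots> \<le> (\<Sum>x\<in>V. (c x)\<^sup>2) / a\<^sup>2"
    using variance_Pi_pmf_le[of V X B c, OF V bound diff]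
    by (simp add: P divide_right_mono)
  finally show ?thesis by (simp add: P_def)
qed

subsection \<open>The expected number of fork tips\<close>

definition maps_inj_over :: "'a set \<Rightarrow> 'b set \<Rightarrow> 'b set \<Rightarrow> ('a \<Rightarrow> 'b) set" where
  "maps_inj_over A C S = {g \<in> A \<rightarrow>\<^sub>E C \<union> S. inj_on g {a \<in> A. g a \<in> S}}"

lemma finite_maps_inj_over:
  assumes "finite A" "finite C" "finite S"
  shows "finite (maps_inj_over A C S)"
  using assms by (simp add: maps_inj_over_def finite_PiE)

lemma maps_inj_over_insert_subset:
  "maps_inj_over A C (insert u S)
    \<subseteq> maps_inj_over A C S \<union> (\<Union>a\<in>A. (\<lambda>g. g(a := u)) ` maps_inj_over (A - {a}) C S)"
proof
  fix g assume g: "g \<in> maps_inj_over A C (insert u S)"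
  then have maps: "g \<in> A \<rightarrow>\<^sub>E C \<union> insert u S" and inj: "inj_on g {a \<in> A. g a \<in> insert u S}"
    by (simp_all add: maps_inj_over_def)
  show "g \<in> maps_inj_over A C S \<union> (\<Union>a\<in>A. (\<lambda>g. g(a := u)) ` maps_inj_over (A - {a}) C S)"
  proof (cases "\<exists>a\<in>A. g a = u")
    case False
    then have "g \<in> A \<rightarrow>\<^sub>E C \<union> S"
      using maps by (auto simp: PiE_iff)
    moreover have "inj_on g {a \<in> A. g a \<in> S}"
      using inj by (rule inj_on_subset) auto
    ultimately show ?thesis
      by (simp add: maps_inj_over_def)
  next
    case True
    then obtain a where a: "a \<in> A" "g a = u" by blast
    define g' where "g' = restrict g (A - {a})"
    have "g = g'(a := u)"
      using a maps by (auto simp: g'_def fun_eq_iff PiE_iff extensional_def)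
    moreover have "g b \<noteq> u" if "b \<in> A - {a}" for b
      using a that inj_onD[OF inj, of a b] by auto
    then have "g' \<in> A - {a} \<rightarrow>\<^sub>E C \<union> S"
      using maps by (auto simp: g'_def PiE_iff)
    moreover have "inj_on g' {b \<in> A - {a}. g' b \<in> S}"
      using inj by (auto simp: g'_def inj_on_def)
    ultimately show ?thesis
      using a(1) by (auto simp: maps_inj_over_def)
  qed
qed

lemma card_maps_inj_over_insert_le:
  assumes "finite A" "finite C" "finite S"
  shows "card (maps_inj_over A C (insert u S))
    \<le> card (maps_inj_over A C S) + (\<Sum>a\<in>A. card (maps_inj_over (A - {a}) C S))"
proof -
  let ?upd = "\<lambda>a. (\<lambda>g. g(a := u)) ` maps_inj_over (A - {a}) C S"
  have "card (maps_inj_over A C (insert u S)) \<le> card (maps_inj_over A C S \<union> (\<Union>a\<in>A. ?upd a))"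
    using assms by (intro card_mono maps_inj_over_insert_subset) (simp add: finite_maps_inj_over)
  also have "\<dots> \<le> card (maps_inj_over A C S) + (\<Sum>a\<in>A. card (?upd a))"
    by (rule order_trans[OF card_Un_le add_left_mono[OF card_UN_le[OF assms(1)]]])
  also have "\<dots> \<le> card (maps_inj_over A C S) + (\<Sum>a\<in>A. card (maps_inj_over (A - {a}) C S))"
    using assms by (intro add_left_mono sum_mono card_image_le finite_maps_inj_over) auto
  finally show ?thesis .
qed

lemma card_maps_inj_over_le:
  assumes "finite S" "finite A" "finite C" "card A \<le> card C"
  shows "card (maps_inj_over A C S) \<le> 2 ^ card S * card C ^ card A"
  using assms
proof (induction S arbitrary: A rule: finite_induct)
  case empty
  then show ?case
    by (simp add: maps_inj_over_def card_PiE)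
next
  case (insert u S)
  let ?bound = "2 ^ card S * card C ^ card A"
  have insertion: "(\<Sum>a\<in>A. card (maps_inj_over (A - {a}) C S)) \<le> ?bound"
  proof (cases "card A")
    case (Suc m)
    have "card (maps_inj_over (A - {a}) C S) \<le> 2 ^ card S * card C ^ m" if "a \<in> A" for a
      using insert.IH[of "A - {a}"] insert.prems that Suc by simp
    then have "(\<Sum>a\<in>A. card (maps_inj_over (A - {a}) C S)) \<le> card A * (2 ^ card S * card C ^ m)"
      using sum_bounded_above[of A "\<lambda>a. card (maps_inj_over (A - {a}) C S)"] by simp
    also have "\<dots> \<le> card C * (2 ^ card S * card C ^ m)"
      using insert.prems(3) by (rule mult_le_mono1)
    finally show ?thesis
      by (simp add: Suc mult.left_commute)
  qed (use insert.prems in simp)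
  have "card (maps_inj_over A C (insert u S))
      \<le> card (maps_inj_over A C S) + (\<Sum>a\<in>A. card (maps_inj_over (A - {a}) C S))"
    using insert by (intro card_maps_inj_over_insert_le) auto
  also have "\<dots> \<le> ?bound + ?bound"
    using insert by (intro add_mono insertion) auto
  finally show ?case
    using insert.hyps by simp
qed

definition other_preimages :: "'a set \<Rightarrow> ('a \<Rightarrow> 'a) \<Rightarrow> 'a \<Rightarrow> 'a set" where
  "other_preimages V f v = {x \<in> V - {v}. f x = v}"

lemma restrict_in_maps_inj_over:
  assumes f: "f \<in> V \<rightarrow>\<^sub>E V" and v: "v \<in> V" "v \<notin> fork_tips V f"
    and R: "R = V - {v} - other_preimages V f v"
  shows "restrict f R \<in> maps_inj_over R R (other_preimages V f v)"
proof -
  let ?S = "other_preimages V f v"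
  have "restrict f R \<in> R \<rightarrow>\<^sub>E R \<union> ?S"
    using f by (auto simp: R other_preimages_def)
  moreover have "inj_on f {a \<in> R. f a \<in> ?S}"
  proof (rule inj_onI, rule ccontr)
    fix a b assume a: "a \<in> {a \<in> R. f a \<in> ?S}" and b: "b \<in> {a \<in> R. f a \<in> ?S}"
      and eq: "f a = f b" and "a \<noteq> b"
    then have "v \<in> fork_tips V f"
      using v(1) by (intro fork_tipsI[of a b "f a"]) (auto simp: R other_preimages_def)
    with v(2) show False ..
  qed
  then have "inj_on (restrict f R) {a \<in> R. restrict f R a \<in> ?S}"
    by (auto simp: inj_on_def)
  ultimately show ?thesis
    by (simp add: maps_inj_over_def)
qed

lemma inj_on_restrict_given_preimages:
  "inj_on (\<lambda>f. (f v, restrict f (V - {v} - S))) {f \<in> V \<rightarrow>\<^sub>E V. other_preimages V f v = S}"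
proof (rule inj_onI)
  let ?R = "V - {v} - S"
  fix f g
  assume f: "f \<in> {f \<in> V \<rightarrow>\<^sub>E V. other_preimages V f v = S}"
    and g: "g \<in> {f \<in> V \<rightarrow>\<^sub>E V. other_preimages V f v = S}"
    and eq: "(f v, restrict f ?R) = (g v, restrict g ?R)"
  have "f x = g x" if "x \<in> V" for x
  proof -
    consider "x = v" | "x \<in> S" | "x \<in> ?R"
      using \<open>x \<in> V\<close> by blast
    then show ?thesis
    proof cases
      assume "x \<in> S"
      then have "x \<in> other_preimages V f v" "x \<in> other_preimages V g v"
        using f g by simp_all
      then show ?thesis
        by (simp add: other_preimages_def)
    next
      assume "x \<in> ?R"
      moreover have "restrict f ?R x = restrict g ?R x"
        using eq by simp
      ultimately show ?thesis
        by simp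
    qed (use eq in simp)
  qed
  then show "f = g"
    using f g by (intro PiE_ext[of f V "\<lambda>_. V" g]) auto
qed

lemma card_not_fork_tip_given_preimages_le:
  assumes V: "finite V" "v \<in> V" and S: "S \<subseteq> V - {v}"
  shows "card {f \<in> V \<rightarrow>\<^sub>E V. v \<notin> fork_tips V f \<and> other_preimages V f v = S}
    \<le> card V * (2 ^ card S * (card V - 1 - card S) ^ (card V - 1 - card S))" (is "card ?F \<le> _")
proof -
  define R where "R = V - {v} - S"
  have fin: "finite R" "finite S"
    using V(1) S by (auto simp: R_def intro: finite_subset)
  have card_R: "card R = card V - 1 - card S"
    using V S fin by (simp add: R_def card_Diff_subset)
  have "inj_on (\<lambda>f. (f v, restrict f R)) ?F"
    unfolding R_def by (rule inj_on_subset[OF inj_on_restrict_given_preimages]) blast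
  moreover have "(\<lambda>f. (f v, restrict f R)) ` ?F \<subseteq> V \<times> maps_inj_over R R S"
    using V(2) restrict_in_maps_inj_over[of _ V v R] by (auto simp: R_def)
  ultimately have "card ?F \<le> card (V \<times> maps_inj_over R R S)"
    using V fin by (intro card_inj_on_le) (auto simp: finite_maps_inj_over)
  also have "\<dots> \<le> card V * (2 ^ card S * card R ^ card R)"
    unfolding card_cartesian_product by (intro mult_le_mono2 card_maps_inj_over_le fin order_refl)
  finally show ?thesis
    by (simp add: card_R)
qed

lemma sum_Pow_card:
  fixes F :: "nat \<Rightarrow> 'b :: comm_semiring_1"
  assumes "finite A"
  shows "(\<Sum>S\<in>Pow A. F (card S)) = (\<Sum>k\<le>card A. of_nat (card A choose k) * F k)"
proof -
  have "(\<Sum>S\<in>Pow A. F (card S)) = (\<Sum>k\<le>card A. \<Sum>S | S \<in> Pow A \<and> card S = k. F (card S))"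
    using assms by (intro sum.group[symmetric]) (auto intro: card_mono)
  also have "\<dots> = (\<Sum>k\<le>card A. of_nat (card A choose k) * F k)"
    using assms by (intro sum.cong refl) (simp add: n_subsets)
  finally show ?thesis .
qed

lemma card_not_fork_tip_le:
  assumes V: "finite V" "v \<in> V"
  shows "card {f \<in> V \<rightarrow>\<^sub>E V. v \<notin> fork_tips V f}
    \<le> card V * (\<Sum>k\<le>card V - 1.
        (card V - 1 choose k) * (2 ^ k * (card V - 1 - k) ^ (card V - 1 - k)))"
proof -
  let ?F = "\<lambda>S. {f \<in> V \<rightarrow>\<^sub>E V. v \<notin> fork_tips V f \<and> other_preimages V f v = S}"
  have "other_preimages V f v \<in> Pow (V - {v})" for f
    by (auto simp: other_preimages_def)
  then have "{f \<in> V \<rightarrow>\<^sub>E V. v \<notin> fork_tips V f} = (\<Union>S\<in>Pow (V - {v}). ?F S)"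
    by blast
  then have "card {f \<in> V \<rightarrow>\<^sub>E V. v \<notin> fork_tips V f} \<le> (\<Sum>S\<in>Pow (V - {v}). card (?F S))"
    using V by (simp add: card_UN_le)
  also have "\<dots> \<le> (\<Sum>S\<in>Pow (V - {v}).
      card V * (2 ^ card S * (card V - 1 - card S) ^ (card V - 1 - card S)))"
    using V by (intro sum_mono card_not_fork_tip_given_preimages_le) auto
  also have "\<dots> = card V * (\<Sum>k\<le>card V - 1.
      (card V - 1 choose k) * (2 ^ k * (card V - 1 - k) ^ (card V - 1 - k)))"
    using V sum_Pow_card[of "V - {v}" "\<lambda>k. 2 ^ k * (card V - 1 - k) ^ (card V - 1 - k)"]
    by (simp flip: sum_distrib_left)
  finally show ?thesis .
qed

text \<open>The \<open>k\<close>-th weight bounds the probability that \<open>v\<close> is no tip and has exactly \<open>k\<close> preimages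
  other than itself: each of these may be hit at most once by the remaining \<open>N - 1 - k\<close> points.\<close>

definition not_fork_tip_weight :: "nat \<Rightarrow> nat \<Rightarrow> real" where
  "not_fork_tip_weight k N
    = real (N - 1 choose k) * (2 ^ k * real (N - 1 - k) ^ (N - 1 - k)) / real N ^ (N - 1)"

lemma not_fork_tip_weight_nonneg: "0 \<le> not_fork_tip_weight k N"
  by (simp add: not_fork_tip_weight_def)

lemma suminf_not_fork_tip_weight:
  assumes "0 < N"
  shows "(\<Sum>k. not_fork_tip_weight k N) = (\<Sum>k\<le>N - 1. not_fork_tip_weight k N)"
  using assms by (intro suminf_finite) (auto simp: not_fork_tip_weight_def)

lemma prob_not_fork_tip_le:
  assumes V: "finite V" "v \<in> V"
  shows "measure_pmf.prob (pmf_of_set (V \<rightarrow>\<^sub>E V)) {f. v \<notin> fork_tips V f}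
    \<le> (\<Sum>k. not_fork_tip_weight k (card V))"
proof -
  define N where "N = card V"
  have N: "0 < N"
    using V by (auto simp: N_def card_gt_0_iff)
  have "V \<rightarrow>\<^sub>E V \<noteq> {}" "finite (V \<rightarrow>\<^sub>E V)"
    using V by (auto simp: PiE_eq_empty_iff finite_PiE)
  then have "measure_pmf.prob (pmf_of_set (V \<rightarrow>\<^sub>E V)) {f. v \<notin> fork_tips V f}
      = real (card {f \<in> V \<rightarrow>\<^sub>E V. v \<notin> fork_tips V f}) / real N ^ N"
    using V by (simp add: measure_pmf_of_set card_PiE N_def Int_def)
  also have "\<dots> \<le> real (N * (\<Sum>k\<le>N - 1. (N - 1 choose k) * (2 ^ k * (N - 1 - k) ^ (N - 1 - k))))
      / real N ^ N"
    using card_not_fork_tip_le[OF V] by (intro divide_right_mono of_nat_mono) (simp_all add: N_def)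
  also have "\<dots> = (\<Sum>k\<le>N - 1. not_fork_tip_weight k N)"
    using N
    by (simp add: not_fork_tip_weight_def power_eq_if[of "real N" N] flip: sum_divide_distrib)
  also have "\<dots> = (\<Sum>k. not_fork_tip_weight k N)"
    using N by (rule suminf_not_fork_tip_weight[symmetric])
  finally show ?thesis
    by (simp add: N_def)
qed

lemma expectation_card_fork_tips_ge:
  assumes V: "finite V"
  shows "real (card V) * (1 - (\<Sum>k. not_fork_tip_weight k (card V)))
    \<le> measure_pmf.expectation (pmf_of_set (V \<rightarrow>\<^sub>E V)) (\<lambda>f. real (card (fork_tips V f)))"
proof -
  define P where "P = pmf_of_set (V \<rightarrow>\<^sub>E V)"
  have card_eq: "(\<Sum>v\<in>V. indicator {f. v \<in> fork_tips V f} f) = real (card (fork_tips V f))" for f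
    using V by (simp add: indicator_def Int_absorb1[OF fork_tips_subset])
  have "1 - (\<Sum>k. not_fork_tip_weight k (card V)) \<le> measure_pmf.prob P {f. v \<in> fork_tips V f}"
    if "v \<in> V" for v
    using prob_not_fork_tip_le[OF V that] measure_pmf.prob_neg[of P "\<lambda>f. v \<in> fork_tips V f"]
    by (simp add: P_def)
  then have "real (card V) * (1 - (\<Sum>k. not_fork_tip_weight k (card V)))
      \<le> (\<Sum>v\<in>V. measure_pmf.prob P {f. v \<in> fork_tips V f})"
    by (rule sum_bounded_below)
  also have "\<dots> = measure_pmf.expectation P (\<lambda>f. \<Sum>v\<in>V. indicator {f. v \<in> fork_tips V f} f)"
    by (subst Bochner_Integration.integral_sum)
      (auto simp: indicator_def intro!: integrable_measure_pmf_bounded[of _ 1])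
  finally show ?thesis
    by (simp add: P_def card_eq)
qed

subsection \<open>The limiting density of fork tips\<close>

lemma not_fork_tip_weight_le: "not_fork_tip_weight k N \<le> 2 ^ k / fact k"
proof (cases "k < N")
  case True
  have "real (N - 1 choose k) * fact k * real (N - 1 - k) ^ (N - 1 - k)
      \<le> real N ^ k * real N ^ (N - 1 - k)"
  proof (intro mult_mono power_mono)
    have "(N - 1 choose k) * fact k \<le> (N - 1) ^ k"
      by (rule binomial_fact_pow)
    also have "\<dots> \<le> N ^ k"
      by (intro power_mono) auto
    finally show "real (N - 1 choose k) * fact k \<le> real N ^ k"
      by (metis of_nat_fact of_nat_le_iff of_nat_mult of_nat_power)
  qed auto
  also have "\<dots> = real N ^ (N - 1)"
    using True by (simp flip: power_add)
  finally show ?thesis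
    using True by (simp add: not_fork_tip_weight_def field_simps)
next
  case False
  then consider "N = 0" "k = 0" | "N - 1 < k" by linarith
  then show ?thesis
    by cases (simp_all add: not_fork_tip_weight_def binomial_eq_0)
qed

lemma tendsto_exp_limit_diff:
  "(\<lambda>N. (1 + x / real N) ^ (N - j)) \<longlonglongrightarrow> exp (x :: real)"
proof -
  have base: "(\<lambda>N. 1 + x / real N) \<longlonglongrightarrow> 1"
    using tendsto_add[OF tendsto_const lim_const_over_n[of x], of 1] by simp
  have "(\<lambda>N. (1 + x / real N) ^ N / (1 + x / real N) ^ j) \<longlonglongrightarrow> exp x / 1 ^ j"
    using base by (intro tendsto_intros tendsto_exp_limit_sequentially) auto
  moreover have "\<forall>\<^sub>F N in sequentially. 0 < 1 + x / real N"
    using base by (rule order_tendstoD) simp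
  then have "\<forall>\<^sub>F N in sequentially.
      (1 + x / real N) ^ N / (1 + x / real N) ^ j = (1 + x / real N) ^ (N - j)"
    using eventually_ge_at_top[of j] by eventually_elim (simp add: power_diff)
  ultimately show ?thesis
    by (simp add: filterlim_cong)
qed

lemma tendsto_choose_over_power:
  "(\<lambda>N. real (N - 1 choose k) / real N ^ k) \<longlonglongrightarrow> 1 / fact k"
proof -
  have "(\<lambda>N. (\<Prod>i=0..<k. 1 - (1 + real i) / real N) / fact k) \<longlonglongrightarrow> (\<Prod>i=0..<k. 1 - 0) / fact k"
    by (intro tendsto_intros lim_const_over_n) auto
  moreover have "\<forall>\<^sub>F N in sequentially. (\<Prod>i=0..<k. 1 - (1 + real i) / real N) / fact k
      = real (N - 1 choose k) / real N ^ k"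
    using eventually_gt_at_top[of 0]
  proof eventually_elim
    case (elim N)
    have "(\<Prod>i=0..<k. 1 - (1 + real i) / real N) = (\<Prod>i=0..<k. (real (N - 1) - real i) / real N)"
      using elim by (intro prod.cong) (auto simp: field_simps of_nat_diff)
    then show ?case
      by (simp add: binomial_gbinomial gbinomial_prod_rev prod_dividef)
  qed
  ultimately show ?thesis
    by (simp add: filterlim_cong)
qed

lemma not_fork_tip_weight_tendsto:
  "not_fork_tip_weight k \<longlonglongrightarrow> exp (- 1) * ((2 * exp (- 1)) ^ k / fact k)"
proof -
  have "(\<lambda>N. real (N - 1 choose k) / real N ^ k
      * (2 ^ k * (1 + (- real (Suc k)) / real N) ^ (N - Suc k)))
    \<longlonglongrightarrow> 1 / fact k * (2 ^ k * exp (- real (Suc k)))"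
    by (intro tendsto_intros tendsto_choose_over_power tendsto_exp_limit_diff)
  also have "exp (- real (Suc k)) = exp (- 1) ^ Suc k"
    by (metis exp_of_nat_mult mult_minus1_right)
  also have "1 / fact k * (2 ^ k * exp (- 1) ^ Suc k)
      = exp (- 1) * ((2 * exp (- 1 :: real)) ^ k / fact k)"
    by (simp add: power_mult_distrib)
  finally show ?thesis
  proof (rule Lim_transform_eventually)
    show "\<forall>\<^sub>F N in sequentially. real (N - 1 choose k) / real N ^ k
        * (2 ^ k * (1 + (- real (Suc k)) / real N) ^ (N - Suc k)) = not_fork_tip_weight k N"
      using eventually_gt_at_top[of k]
    proof eventually_elim
      case (elim N)
      then have "1 + (- real (Suc k)) / real N = real (N - 1 - k) / real N"
        by (simp add: field_simps of_nat_diff)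
      moreover have "real N ^ (N - 1) = real N ^ k * real N ^ (N - 1 - k)"
        using elim by (simp flip: power_add)
      ultimately show ?case
        by (simp add: not_fork_tip_weight_def power_divide)
    qed
  qed
qed

lemma suminf_not_fork_tip_weight_tendsto:
  "(\<lambda>N. \<Sum>k. not_fork_tip_weight k N) \<longlonglongrightarrow> exp (2 / exp 1 - 1)"
proof -
  have "(\<lambda>k. inverse (fact k) *\<^sub>R (2::real) ^ k) sums exp 2"
    by (rule exp_converges)
  then have summable: "summable (\<lambda>k. 2 ^ k / fact k :: real)"
    by (simp add: sums_iff field_simps)
  have "(\<lambda>k. (2 * exp (- 1)) ^ k / fact k :: real) sums exp (2 * exp (- 1))"
    using exp_converges[of "2 * exp (- 1 :: real)"] by (simp add: field_simps)
  then have "(\<lambda>k. exp (- 1) * ((2 * exp (- 1)) ^ k / fact k) :: real)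
      sums (exp (- 1) * exp (2 * exp (- 1)))"
    by (rule sums_mult)
  also have "exp (- 1) * exp (2 * exp (- 1 :: real)) = exp (2 / exp 1 - 1)"
    by (simp add: exp_diff exp_minus divide_inverse mult.commute)
  finally have "(\<Sum>k. exp (- 1) * ((2 * exp (- 1)) ^ k / fact k)) = exp (2 / exp 1 - 1 :: real)"
    by (rule sums_unique[symmetric])
  moreover have "(\<lambda>N. \<Sum>k. not_fork_tip_weight k N)
      \<longlonglongrightarrow> (\<Sum>k. exp (- 1) * ((2 * exp (- 1)) ^ k / fact k))"
    using tannerys_theorem[of not_fork_tip_weight, OF not_fork_tip_weight_tendsto _ summable]
    by (simp add: not_fork_tip_weight_nonneg not_fork_tip_weight_le case_prod_unfold)
  ultimately show ?thesis
    by simp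
qed

lemma prob_few_fork_tips_le:
  fixes \<alpha> \<beta> :: real
  assumes V: "finite V" "V \<noteq> {}"
    and "\<alpha> < \<beta>" and density: "\<beta> \<le> 1 - (\<Sum>k. not_fork_tip_weight k (card V))"
  shows "measure_pmf.prob (pmf_of_set (V \<rightarrow>\<^sub>E V)) {f. card (fork_tips V f) < \<alpha> * real (card V)}
    \<le> 4 / (\<beta> - \<alpha>)\<^sup>2 / real (card V)" (is "?p \<le> _")
proof -
  let ?N = "real (card V)"
  have N: "0 < ?N"
    using V by (simp add: card_gt_0_iff)
  have "\<alpha> * ?N + (\<beta> - \<alpha>) * ?N = ?N * \<beta>"
    by (simp add: algebra_simps)
  also have "\<dots> \<le> ?N * (1 - (\<Sum>k. not_fork_tip_weight k (card V)))"
    using density by (intro mult_left_mono) auto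
  also have "\<dots> \<le> measure_pmf.expectation (pmf_of_set (V \<rightarrow>\<^sub>E V)) (\<lambda>f. real (card (fork_tips V f)))"
    using V(1) by (rule expectation_card_fork_tips_ge)
  finally have "?p \<le> (\<Sum>x\<in>V. 2\<^sup>2) / ((\<beta> - \<alpha>) * ?N)\<^sup>2"
    using V N \<open>\<alpha> < \<beta>\<close>
    by (intro lower_tail_pmf_of_set_PiE_le[where B = ?N] card_fork_tips_fun_upd)
      (auto simp: card_mono fork_tips_subset)
  also have "\<dots> = 4 / (\<beta> - \<alpha>)\<^sup>2 / ?N"
    using N by (simp add: power_mult_distrib power2_eq_square[of ?N])
  finally show ?thesis .
qed

lemma prob_few_fork_tips_tendsto_0:
  fixes V :: "nat \<Rightarrow> 'a set" and \<alpha> :: real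
  assumes fin: "\<And>n. finite (V n)" and card: "filterlim (\<lambda>n. card (V n)) at_top sequentially"
    and \<alpha>: "\<alpha> < 1 - exp (2 / exp 1 - 1)"
  shows "(\<lambda>n. measure_pmf.prob (pmf_of_set (V n \<rightarrow>\<^sub>E V n))
      {f. card (fork_tips (V n) f) < \<alpha> * real (card (V n))}) \<longlonglongrightarrow> 0" (is "?p \<longlonglongrightarrow> 0")
proof -
  obtain \<beta> where "\<alpha> < \<beta>" and \<beta>: "\<beta> < 1 - exp (2 / exp 1 - 1)"
    using dense[OF \<alpha>] by blast
  have "(\<lambda>N. 1 - (\<Sum>k. not_fork_tip_weight k N)) \<longlonglongrightarrow> 1 - exp (2 / exp 1 - 1)"
    by (intro tendsto_intros suminf_not_fork_tip_weight_tendsto)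
  then have "\<forall>\<^sub>F N in sequentially. \<beta> < 1 - (\<Sum>k. not_fork_tip_weight k N)"
    using \<beta> by (rule order_tendstoD)
  then have "\<forall>\<^sub>F n in sequentially. \<beta> < 1 - (\<Sum>k. not_fork_tip_weight k (card (V n)))"
    using card by (rule eventually_compose_filterlim)
  moreover have "\<forall>\<^sub>F n in sequentially. 0 < card (V n)"
    using eventually_gt_at_top card by (rule eventually_compose_filterlim)
  ultimately have upper: "\<forall>\<^sub>F n in sequentially. ?p n \<le> 4 / (\<beta> - \<alpha>)\<^sup>2 / real (card (V n))"
  proof eventually_elim
    case (elim n)
    then show ?case
      using fin \<open>\<alpha> < \<beta>\<close> by (intro prob_few_fork_tips_le) auto
  qed
  have upper_lim: "(\<lambda>n. 4 / (\<beta> - \<alpha>)\<^sup>2 / real (card (V n))) \<longlonglongrightarrow> 0"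
    using filterlim_compose[OF lim_const_over_n card] .
  show ?thesis
    by (rule tendsto_sandwich[OF _ upper tendsto_const upper_lim]) simp
qed

lemma fork_tip_density_gt: "0.23 < 1 - exp (2 / exp 1 - 1 :: real)"
proof -
  define x :: real where "x = 1 - 2 / exp 1"
  have "\<bar>exp 1 - 5837465777 / 2147483648\<bar> \<le> (1 / 4294967296 :: real)"
    using e_approx_32 by simp
  then have "2.718 \<le> (exp 1 :: real)"
    unfolding abs_le_iff by simp
  then have x: "0.2641 \<le> x"
    by (simp add: x_def field_simps)
  then have "1 / 0.77 < 1 + x + x\<^sup>2 / 2"
    using power_mono[of "0.2641" x 2] by (simp add: power2_eq_square)
  also have "\<dots> \<le> exp x"
    using x by (intro exp_lower_Taylor_quadratic) simp
  finally have "exp (- x) < 0.77"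
    by (simp add: exp_minus field_simps)
  then show ?thesis
    by (simp add: x_def)
qed

lemma prob_many_small_attractors_ge:
  fixes t :: real
  assumes "2 \<le> n"
  shows "1 - measure_pmf.prob (pmf_of_set (boolean_networks n))
      {f. card (fork_tips (configs n) f) < 5 * t}
    \<le> measure_pmf.prob (pmf_of_set (boolean_networks n))
      {f. \<exists>h\<in>boolean_networks n. sync_equiv n h f \<and> t \<le> real (card (small_attractors n h))}"
    (is "1 - measure_pmf.prob ?P ?few \<le> measure_pmf.prob ?P ?many")
proof -
  have "f \<in> ?many" if "f \<in> boolean_networks n" "f \<notin> ?few" for f
    using exists_sync_equiv_many_small_attractors[OF that(1) assms] that(2) by fastforce
  then have "measure_pmf.prob ?P (- ?few) \<le> measure_pmf.prob ?P ?many"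
    using boolean_networks_nonempty finite_boolean_networks
    by (intro measure_pmf.finite_measure_mono_AE) (auto simp: AE_measure_pmf_iff set_pmf_of_set)
  then show ?thesis
    using measure_pmf.prob_compl[of ?few ?P] by (simp add: Compl_eq_Diff_UNIV)
qed

theorem theorem4:
  "(\<lambda>n. measure_pmf.prob (pmf_of_set (boolean_networks n))
      {f. \<exists>h \<in> boolean_networks n. sync_equiv n h f \<and>
            0.046 * 2 ^ n \<le>
              real (card {X. is_attractor (configs n) (async_arcs n h) X \<and> card X \<le> 4})})
    \<longlonglongrightarrow> 1"
  unfolding small_attractors_def[symmetric]
proof (rule tendsto_sandwich[OF _ _ _ tendsto_const])
  let ?few = "\<lambda>n. measure_pmf.prob (pmf_of_set (boolean_networks n))
    {f. card (fork_tips (configs n) f) < 5 * (0.046 * 2 ^ n :: real)}"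
  show "\<forall>\<^sub>F n in sequentially. 1 - ?few n \<le> measure_pmf.prob (pmf_of_set (boolean_networks n))
      {f. \<exists>h \<in> boolean_networks n. sync_equiv n h f \<and>
        0.046 * 2 ^ n \<le> real (card (small_attractors n h))}"
    using eventually_ge_at_top[of 2] by eventually_elim (rule prob_many_small_attractors_ge)
  have "filterlim (\<lambda>n. card (configs n)) at_top sequentially"
    by (rule filterlim_subseq) (simp add: strict_mono_def card_configs)
  from prob_few_fork_tips_tendsto_0[OF finite_configs this fork_tip_density_gt]
  have "?few \<longlonglongrightarrow> 0"
    by (simp add: boolean_networks_def card_configs)
  from tendsto_diff[OF tendsto_const this] show "(\<lambda>n. 1 - ?few n) \<longlonglongrightarrow> 1"
    by simp
qed simp

end
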